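(* Let $(X,d)$ be a complete $b$-metric space with coefficient $s \geq 1$. For each $i\in\mathbb{N}_0$ let $T_i:X\to X$ be a weak quasi-contraction, and suppose that $$\operatorname{diam}\mathcal{O}_{T_j}(T_ix,T_iy)\leq\operatorname{diam}\mathcal{O}_{T_j}(x,y)\quad\text{for all } x,y\in X,\ i,j\in\mathbb{N}_0.$$ Let $\mathfrak{F}$ be a nonempty set of mappings $f:\mathbb{N}_0\to\mathbb{N}_0$ with the shift property: if $f\in\mathfrak{F}$ and $p\in\mathbb{N}$, then $f_p\in\mathfrak{F}$, where $f_p(i)=f(i+p)$ for all $i\in\mathbb{N}_0$. Suppose that for each $\epsilon>0$ there exists a natural number $n_\epsilon$ such that for each $f\in\mathfrak{F}$ and each $x,y\in X$, $$d(T_{f(n_\epsilon)}T_{f(n_\epsilon-1)}\cdots T_{f(1)}T_{f(0)}x,\;T_{f(n_\epsilon)}T_{f(n_\epsilon-1)}\cdots T_{f(1)}T_{f(0)}y)<\epsilon.$$ Let $\{\delta_i\}_{i=0}^\infty$ be a sequence of positive numbers with $\lim_{i\to\infty}\delta_i=0$. Then for each $\epsilon>0$ there exists $\check{n}\in\mathbb{N}$ such that for each $f\in\mathfrak{F}$ and each pair of sequences $\{x_i\}_{i=0}^\infty,\{y_i\}_{i=0}^\infty\subset X$ satisfying $$\operatorname{diam}\mathcal{O}_{T_{f(j)}}(x_{i+1},T_{f(i)}x_i)\leq\delta_i\quad\text{and}\quad \operatorname{diam}\mathcal{O}_{T_{f(j)}}(y_{i+1},T_{f(i)}y_i)\leq\delta_i\quad\text{for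 all } i,j\in\mathbb{N}_0,$$ one has $d(x_i,y_i)<\epsilon$ for all $i\geq\check{n}$.
   Context: $\mathbb{N}$ is the set of natural numbers (positive integers) and $\mathbb{N}_0=\mathbb{N}\cup\{0\}$. A $b$-metric space with coefficient $s\geq1$ is a nonempty set $X$ with $d:X\times X\to[0,\infty)$ such that for all $x,y,z\in X$: $d(x,y)=0$ iff $x=y$; $d(x,y)=d(y,x)$; $d(x,y)\leq s[d(x,z)+d(z,y)]$. A sequence $\{x_n\}$ converges to $x$ iff $d(x_n,x)\to0$; it is Cauchy iff $d(x_n,x_m)\to0$ as $n,m\to\infty$; $(X,d)$ is complete if every Cauchy sequence converges in $X$. For $T:X\to X$: $T^0$ is the identity, $T^{n+1}=T\circ T^n$, $\mathcal{O}_T(x)=\{T^nx:n\in\mathbb{N}_0\}$, $\mathcal{O}_T(x,y)=\mathcal{O}_T(x)\cup\mathcal{O}_T(y)$; $\operatorname{diam}A=\sup\{d(u,v):u,v\in A\}$. $T$ is a weak quasi-contraction if every orbit $\mathcal{O}_T(x)$ is bounded and $d(Tx,Ty)\leq\psi(\operatorname{diam}\mathcal{O}_T(x,y))$ for all $x,y\in X$, for some $\psi:[0,\infty)\to[0,\infty)$ that is increasing and upper semi-continuous with $\psi(0)=0$ and $\psi(t)<t$ for all $t>0$. *)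

theory Defs
  imports Complex_Main "HOL-Library.FuncSet"
begin

locale b_metric_space =
  fixes X :: "'a set" and d :: "'a \<Rightarrow> 'a \<Rightarrow> real" and s :: real
  assumes nonempty: "X \<noteq> {}"
    and coeff_ge_1: "1 \<le> s"
    and nonneg: "x \<in> X \<Longrightarrow> y \<in> X \<Longrightarrow> 0 \<le> d x y"
    and zero_iff: "x \<in> X \<Longrightarrow> y \<in> X \<Longrightarrow> d x y = 0 \<longleftrightarrow> x = y"
    and sym: "x \<in> X \<Longrightarrow> y \<in> X \<Longrightarrow> d x y = d y x"
    and triangle: "x \<in> X \<Longrightarrow> y \<in> X \<Longrightarrow> z \<in> X \<Longrightarrow> d x y \<le> s * (d x z + d z y)"

definition b_converges :: "('a \<Rightarrow> 'a \<Rightarrow> real) \<Rightarrow> (nat \<Rightarrow> 'a) \<Rightarrow> 'a \<Rightarrow> bool" where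
  "b_converges d x l \<longleftrightarrow> (\<lambda>n. d (x n) l) \<longlonglongrightarrow> 0"

definition b_Cauchy :: "('a \<Rightarrow> 'a \<Rightarrow> real) \<Rightarrow> (nat \<Rightarrow> 'a) \<Rightarrow> bool" where
  "b_Cauchy d x \<longleftrightarrow> (\<forall>\<epsilon>>0. \<exists>N. \<forall>n\<ge>N. \<forall>m\<ge>N. d (x n) (x m) < \<epsilon>)"

definition b_complete :: "'a set \<Rightarrow> ('a \<Rightarrow> 'a \<Rightarrow> real) \<Rightarrow> bool" where
  "b_complete X d \<longleftrightarrow>
     (\<forall>x. range x \<subseteq> X \<and> b_Cauchy d x \<longrightarrow> (\<exists>l\<in>X. b_converges d x l))"

definition b_bounded :: "('a \<Rightarrow> 'a \<Rightarrow> real) \<Rightarrow> 'a set \<Rightarrow> bool" where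
  "b_bounded d A \<longleftrightarrow> (\<exists>M. \<forall>u\<in>A. \<forall>v\<in>A. d u v \<le> M)"

text \<open>The supremum is taken in the reals, so it is the diameter only of nonempty bounded sets.
  Below it is applied only to unions of two orbits of a map whose orbits are all bounded, and by
  the relaxed triangle inequality such unions are bounded.\<close>

definition b_diam :: "('a \<Rightarrow> 'a \<Rightarrow> real) \<Rightarrow> 'a set \<Rightarrow> real" where
  "b_diam d A = Sup {d u v | u v. u \<in> A \<and> v \<in> A}"

definition iter_orbit :: "('a \<Rightarrow> 'a) \<Rightarrow> 'a \<Rightarrow> 'a set" where
  "iter_orbit T x = {(T ^^ n) x | n. True}"

definition iter_orbit2 :: "('a \<Rightarrow> 'a) \<Rightarrow> 'a \<Rightarrow> 'a \<Rightarrow> 'a set" where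
  "iter_orbit2 T x y = iter_orbit T x \<union> iter_orbit T y"

definition upper_semicontinuous_on :: "real set \<Rightarrow> (real \<Rightarrow> real) \<Rightarrow> bool" where
  "upper_semicontinuous_on S g \<longleftrightarrow>
     (\<forall>t\<in>S. \<forall>c>g t. eventually (\<lambda>r. g r < c) (at t within S))"

definition comparison_fun :: "(real \<Rightarrow> real) \<Rightarrow> bool" where
  "comparison_fun \<psi> \<longleftrightarrow>
     \<psi> \<in> {0..} \<rightarrow> {0..} \<and> mono_on {0..} \<psi> \<and> upper_semicontinuous_on {0..} \<psi> \<and>
     \<psi> 0 = 0 \<and> (\<forall>t>0. \<psi> t < t)"

definition weak_quasi_contraction ::
    "'a set \<Rightarrow> ('a \<Rightarrow> 'a \<Rightarrow> real) \<Rightarrow> ('a \<Rightarrow> 'a) \<Rightarrow> bool" where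
  "weak_quasi_contraction X d T \<longleftrightarrow>
     T \<in> X \<rightarrow> X \<and>
     (\<forall>x\<in>X. b_bounded d (iter_orbit T x)) \<and>
     (\<exists>\<psi>. comparison_fun \<psi> \<and>
        (\<forall>x\<in>X. \<forall>y\<in>X. d (T x) (T y) \<le> \<psi> (b_diam d (iter_orbit2 T x y))))"

text \<open>The product has n + 1 factors: index n on the left down to index 0 on the right.\<close>

primrec comp_upto :: "(nat \<Rightarrow> 'a \<Rightarrow> 'a) \<Rightarrow> (nat \<Rightarrow> nat) \<Rightarrow> nat \<Rightarrow> 'a \<Rightarrow> 'a" where
  "comp_upto T f 0 x = T (f 0) x"
| "comp_upto T f (Suc n) x = T (f (Suc n)) (comp_upto T f n x)"

end

theory Submission
  imports Defs
begin

text \<open>For a map \<open>T\<close> with bounded orbits, the joint orbit diameter \<open>diam O\<^sub>T(u, v)\<close> dominates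
  \<open>d u v\<close> and satisfies the same relaxed triangle inequality as \<open>d\<close>. By assumption every \<open>T\<^sub>i\<close> is
  nonexpansive for it, so over a window of fixed length an inexact orbit stays within a constant
  multiple of the errors \<open>\<delta>\<^sub>i\<close> of the exact orbit started at the beginning of the window. By the
  shift property, the exact orbits over a window of length \<open>n\<^sub>\<epsilon> + 1\<close> bring any two points close
  together; placing the window late enough makes the errors negligible.\<close>

lemma iter_orbit_refl: "x \<in> iter_orbit T x"
  unfolding iter_orbit_def by (auto intro: exI[of _ 0])

lemma iter_orbit_subset:
  assumes "T \<in> X \<rightarrow> X" "x \<in> X"
  shows "iter_orbit T x \<subseteq> X"
proof -
  have "(T ^^ n) x \<in> X" for n
    using assms by (induction n) auto
  then show ?thesis
    unfolding iter_orbit_def by blast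
qed

lemma comp_upto_in:
  assumes "\<And>i. T i \<in> X \<rightarrow> X" "x \<in> X"
  shows "comp_upto T f n x \<in> X"
proof (induction n)
  case 0
  show ?case using assms(1)[of "f 0"] assms(2) by auto
next
  case (Suc n)
  then show ?case using assms(1)[of "f (Suc n)"] by auto
qed

lemma b_diam_upper:
  assumes "b_bounded d A" "u \<in> A" "v \<in> A"
  shows "d u v \<le> b_diam d A"
  unfolding b_diam_def
proof (rule cSup_upper)
  show "bdd_above {d u v |u v. u \<in> A \<and> v \<in> A}"
    using assms(1) unfolding b_bounded_def bdd_above_def by blast
qed (use assms in blast)

lemma b_diam_least:
  assumes "A \<noteq> {}" "\<And>u v. u \<in> A \<Longrightarrow> v \<in> A \<Longrightarrow> d u v \<le> M"
  shows "b_diam d A \<le> M"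
  unfolding b_diam_def using assms by (intro cSup_least) blast+

context b_metric_space
begin

text \<open>Fix anchors \<open>a\<close> in \<open>A\<close> and \<open>b\<close> in
  \<open>B\<close>: a distance between the two sets is bounded along the path u, a, b, v by two uses
  of the relaxed triangle inequality, whence the nested factor \<open>s\<close> in
  \<open>L\<close>.\<close>

lemma b_bounded_Un:
  assumes "A \<subseteq> X" "B \<subseteq> X" "b_bounded d A" "b_bounded d B"
  shows "b_bounded d (A \<union> B)"
proof (cases "A = {} \<or> B = {}")
  case True
  then show ?thesis using assms by auto
next
  case False
  then obtain a b where ab: "a \<in> A" "b \<in> B" by auto
  obtain M where M: "\<And>u v. u \<in> A \<Longrightarrow> v \<in> A \<Longrightarrow> d u v \<le> M"
    using assms(3) unfolding b_bounded_def by blast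
  obtain N where N: "\<And>u v. u \<in> B \<Longrightarrow> v \<in> B \<Longrightarrow> d u v \<le> N"
    using assms(4) unfolding b_bounded_def by blast
  define L where "L = s * (M + s * (d a b + N))"
  have cross: "d u v \<le> L" if "u \<in> A" "v \<in> B" for u v
  proof -
    have "d a v \<le> s * (d a b + d b v)"
      using triangle[of a v b] ab that assms by auto
    also have "\<dots> \<le> s * (d a b + N)"
      using N[of b v] ab that coeff_ge_1 by (intro mult_left_mono) auto
    finally have "d u a + d a v \<le> M + s * (d a b + N)"
      using M[of u a] ab that by linarith
    moreover have "d u v \<le> s * (d u a + d a v)"
      using triangle[of u v a] ab that assms by auto
    ultimately show ?thesis
      unfolding L_def
      using coeff_ge_1 mult_left_mono[of "d u a + d a v" "M + s * (d a b + N)" s] by linarith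
  qed
  have "d u v \<le> max L (max M N)" if uv: "u \<in> A \<union> B" "v \<in> A \<union> B" for u v
  proof -
    consider "u \<in> A" "v \<in> A" | "u \<in> B" "v \<in> B" | "u \<in> A" "v \<in> B" | "u \<in> B" "v \<in> A"
      using uv by blast
    then show ?thesis
    proof cases
      case 4
      then have "d u v = d v u" using sym assms by blast
      then show ?thesis using cross[of v u] 4 by simp
    qed (use M N cross in \<open>auto simp: le_max_iff_disj\<close>)
  qed
  then show ?thesis unfolding b_bounded_def by blast
qed

context
  fixes T :: "'a \<Rightarrow> 'a"
  assumes maps: "T \<in> X \<rightarrow> X"
    and bounded_orbits: "\<forall>x\<in>X. b_bounded d (iter_orbit T x)"
begin

text \<open>A joint orbit is a union of two bounded orbits, hence bounded, so the real supremum in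
  \<open>b_diam\<close> is a genuine upper bound.\<close>

lemma dist_le_diam_iter_orbit2:
  assumes "x \<in> X" "y \<in> X" "u \<in> iter_orbit2 T x y" "v \<in> iter_orbit2 T x y"
  shows "d u v \<le> b_diam d (iter_orbit2 T x y)"
  using assms maps bounded_orbits unfolding iter_orbit2_def
  by (intro b_diam_upper b_bounded_Un iter_orbit_subset) auto

lemma dist_le_diam_orbits:
  assumes "x \<in> X" "y \<in> X"
  shows "d x y \<le> b_diam d (iter_orbit2 T x y)"
  using assms by (intro dist_le_diam_iter_orbit2) (auto simp: iter_orbit2_def iter_orbit_refl)

text \<open>The point \<open>z\<close> itself lies in both joint orbits on the right, so a pair from
  different orbits is joined through \<open>z\<close>. A pair from one orbit is already within
  \<open>?D1\<close> or \<open>?D2\<close>, and since s is at least 1 and both diameters are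
  nonnegative, either one is absorbed by the right-hand side.\<close>

lemma diam_orbits_triangle:
  assumes "x \<in> X" "y \<in> X" "z \<in> X"
  shows "b_diam d (iter_orbit2 T x y) \<le>
           s * (b_diam d (iter_orbit2 T x z) + b_diam d (iter_orbit2 T z y))"
    (is "_ \<le> s * (?D1 + ?D2)")
proof (rule b_diam_least)
  show "iter_orbit2 T x y \<noteq> {}"
    unfolding iter_orbit2_def using iter_orbit_refl[of x T] by auto
next
  have sub: "iter_orbit T x \<subseteq> X" "iter_orbit T y \<subseteq> X"
    using iter_orbit_subset[OF maps] assms by auto
  have le1: "d u v \<le> ?D1" if "u \<in> iter_orbit2 T x z" "v \<in> iter_orbit2 T x z" for u v
    using that assms by (intro dist_le_diam_iter_orbit2) auto
  have le2: "d u v \<le> ?D2" if "u \<in> iter_orbit2 T z y" "v \<in> iter_orbit2 T z y" for u v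
    using that assms by (intro dist_le_diam_iter_orbit2) auto
  have z: "z \<in> iter_orbit2 T x z" "z \<in> iter_orbit2 T z y"
    unfolding iter_orbit2_def using iter_orbit_refl[of z T] by auto
  have D: "0 \<le> ?D1" "0 \<le> ?D2"
    using le1[OF z(1) z(1)] le2[OF z(2) z(2)] nonneg[of z z] assms by auto
  then have sum_le: "?D1 + ?D2 \<le> s * (?D1 + ?D2)"
    using coeff_ge_1 mult_right_mono[of 1 s "?D1 + ?D2"] by simp
  have cross: "d u v \<le> s * (?D1 + ?D2)" if "u \<in> iter_orbit T x" "v \<in> iter_orbit T y" for u v
  proof -
    have "d u z + d z v \<le> ?D1 + ?D2"
      using le1[of u z] le2[of z v] z that by (auto simp: iter_orbit2_def)
    moreover have "d u v \<le> s * (d u z + d z v)"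
      using triangle[of u v z] that sub assms by blast
    ultimately show ?thesis
      using coeff_ge_1 mult_left_mono[of "d u z + d z v" "?D1 + ?D2" s] by linarith
  qed
  fix u v
  assume "u \<in> iter_orbit2 T x y" "v \<in> iter_orbit2 T x y"
  then consider "u \<in> iter_orbit T x" "v \<in> iter_orbit T x" | "u \<in> iter_orbit T y" "v \<in> iter_orbit T y"
    | "u \<in> iter_orbit T x" "v \<in> iter_orbit T y" | "u \<in> iter_orbit T y" "v \<in> iter_orbit T x"
    unfolding iter_orbit2_def by blast
  then show "d u v \<le> s * (?D1 + ?D2)"
  proof cases
    case 1
    then have "d u v \<le> ?D1" by (intro le1) (auto simp: iter_orbit2_def)
    then show ?thesis using D sum_le by linarith
  next
    case 2
    then have "d u v \<le> ?D2" by (intro le2) (auto simp: iter_orbit2_def)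
    then show ?thesis using D sum_le by linarith
  next
    case 3
    then show ?thesis by (rule cross)
  next
    case 4
    then have "d u v = d v u" using sym sub by blast
    then show ?thesis using cross[of v u] 4 by simp
  qed
qed

end

text \<open>Each step inserts the exact image of the inexact point. The distance then splits into a
  fresh error of at most \<eta> and the old deviation, which nonexpansiveness carries through the
  map. Bounding both by the old bound costs a factor 2, and the triangle inequality a factor s. The
  index \<open>j\<close> of the measuring orbits stays fixed throughout.\<close>

lemma inexact_orbit_deviation:
  fixes T :: "nat \<Rightarrow> 'a \<Rightarrow> 'a"
  assumes maps: "\<And>i. T i \<in> X \<rightarrow> X"
    and bounded: "\<And>i. \<forall>x\<in>X. b_bounded d (iter_orbit (T i) x)"
    and nonexp: "\<And>x y i j. x \<in> X \<Longrightarrow> y \<in> X \<Longrightarrow>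
           b_diam d (iter_orbit2 (T j) (T i x) (T i y)) \<le> b_diam d (iter_orbit2 (T j) x y)"
    and x: "range x \<subseteq> X"
    and err: "\<And>i. b_diam d (iter_orbit2 (T j) (x (Suc i)) (T (f i) (x i))) \<le> \<eta>"
  shows "b_diam d (iter_orbit2 (T j) (x (Suc m)) (comp_upto T f m (x 0))) \<le> (2 * s) ^ m * \<eta>"
proof (induction m)
  case 0
  show ?case using err[of 0] by simp
next
  case (Suc m)
  have xX: "x i \<in> X" for i using x by blast
  have TX: "T i u \<in> X" if "u \<in> X" for i u using maps[of i] that by blast
  let ?c = "comp_upto T f m (x 0)"
  let ?T = "T (f (Suc m))"
  let ?D = "\<lambda>u v. b_diam d (iter_orbit2 (T j) u v)"
  have cX: "?c \<in> X" using comp_upto_in[OF maps xX] .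
  \<comment> \<open>The sign of \<eta> follows from \<open>err\<close> at 0. It is what allows a
    fresh error to be enlarged to \<open>(2 * s) ^ m * \<eta>\<close>.\<close>
  have "0 \<le> d (x 1) (T (f 0) (x 0))" using nonneg xX TX by blast
  also have "\<dots> \<le> ?D (x 1) (T (f 0) (x 0))"
    by (rule dist_le_diam_orbits[OF maps bounded]) (use xX TX in auto)
  finally have "0 \<le> \<eta>" using err[of 0] by simp
  moreover have "1 \<le> (2 * s) ^ m" using coeff_ge_1 by (intro one_le_power) simp
  ultimately have eta: "\<eta> \<le> (2 * s) ^ m * \<eta>"
    using mult_right_mono[of 1 "(2 * s) ^ m" \<eta>] by simp
  have "?D (x (Suc (Suc m))) (?T ?c) \<le>
      s * (?D (x (Suc (Suc m))) (?T (x (Suc m))) + ?D (?T (x (Suc m))) (?T ?c))"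
    by (rule diam_orbits_triangle[OF maps bounded]) (use xX TX cX in auto)
  also have "\<dots> \<le> s * ((2 * s) ^ m * \<eta> + (2 * s) ^ m * \<eta>)"
  proof (intro mult_left_mono add_mono)
    show "?D (x (Suc (Suc m))) (?T (x (Suc m))) \<le> (2 * s) ^ m * \<eta>"
      using err[of "Suc m"] eta by simp
    show "?D (?T (x (Suc m))) (?T ?c) \<le> (2 * s) ^ m * \<eta>"
      using nonexp[where i = "f (Suc m)" and j = j, OF xX[of "Suc m"] cX] Suc.IH by linarith
  qed (use coeff_ge_1 in simp)
  finally show ?case by (simp add: algebra_simps)
qed

end

theorem theorem3p2:
  fixes X :: "'a set" and d :: "'a \<Rightarrow> 'a \<Rightarrow> real" and s :: real
    and T :: "nat \<Rightarrow> 'a \<Rightarrow> 'a" and F :: "(nat \<Rightarrow> nat) set" and \<delta> :: "nat \<Rightarrow> real"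
  assumes "b_metric_space X d s"
    and "b_complete X d"
    and "\<And>i. weak_quasi_contraction X d (T i)"
    and "\<And>x y i j. x \<in> X \<Longrightarrow> y \<in> X \<Longrightarrow>
           b_diam d (iter_orbit2 (T j) (T i x) (T i y)) \<le> b_diam d (iter_orbit2 (T j) x y)"
    and "F \<noteq> {}"
    and "\<And>f p. f \<in> F \<Longrightarrow> p \<ge> 1 \<Longrightarrow> (\<lambda>i. f (i + p)) \<in> F"
    and "\<And>\<epsilon>::real. \<epsilon> > 0 \<Longrightarrow>
           \<exists>n\<ge>1. \<forall>f\<in>F. \<forall>x\<in>X. \<forall>y\<in>X. d (comp_upto T f n x) (comp_upto T f n y) < \<epsilon>"
    and "\<And>i. \<delta> i > 0"
    and "\<delta> \<longlonglongrightarrow> 0"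
  shows "\<forall>\<epsilon>::real. \<epsilon> > 0 \<longrightarrow>
           (\<exists>N\<ge>1. \<forall>f\<in>F. \<forall>x y :: nat \<Rightarrow> 'a.
              range x \<subseteq> X \<and> range y \<subseteq> X \<and>
              (\<forall>i j. b_diam d (iter_orbit2 (T (f j)) (x (Suc i)) (T (f i) (x i))) \<le> \<delta> i \<and>
                     b_diam d (iter_orbit2 (T (f j)) (y (Suc i)) (T (f i) (y i))) \<le> \<delta> i) \<longrightarrow>
              (\<forall>i\<ge>N. d (x i) (y i) < \<epsilon>))"
proof (intro allI impI)
  fix \<epsilon> :: real
  assume eps: "\<epsilon> > 0"
  interpret b_metric_space X d s by fact
  have s: "s \<ge> 1" by (rule coeff_ge_1)
  have maps: "T i \<in> X \<rightarrow> X" for i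
    using assms(3)[of i] unfolding weak_quasi_contraction_def by blast
  have bounded: "\<forall>x\<in>X. b_bounded d (iter_orbit (T i) x)" for i
    using assms(3)[of i] unfolding weak_quasi_contraction_def by blast
  \<comment> \<open>In the final estimate the distance between the two exact orbits carries the
    factor s^2, so this threshold leaves it less than half of \<epsilon>.\<close>
  obtain n where n: "\<And>g u v. g \<in> F \<Longrightarrow> u \<in> X \<Longrightarrow> v \<in> X \<Longrightarrow>
      d (comp_upto T g n u) (comp_upto T g n v) < \<epsilon> / (2 * s\<^sup>2)"
    using assms(7)[of "\<epsilon> / (2 * s\<^sup>2)"] eps s by auto
  \<comment> \<open>\<open>C\<close> is the deviation factor for a window of n + 1 maps, and
    \<open>a\<close> is the total weight of the two deviations in the final estimate. The choice of
    \<eta> makes them cost exactly the other half of \<epsilon>.\<close>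
  define C where "C = (2 * s) ^ n"
  define a where "a = s + s\<^sup>2"
  define \<eta> where "\<eta> = \<epsilon> / (2 * a * C)"
  have C: "C > 0" unfolding C_def using s by simp
  have a: "a > 0" unfolding a_def using s by (intro add_pos_nonneg) auto
  have eta: "\<eta> > 0" unfolding \<eta>_def using eps C a by simp
  have budget: "a * (C * \<eta>) = \<epsilon> / 2"
    unfolding \<eta>_def using C a by simp
  obtain K where K: "\<And>i. i \<ge> K \<Longrightarrow> \<delta> i < \<eta>"
    using order_tendstoD(2)[OF assms(9) eta] unfolding eventually_sequentially by blast
  show "\<exists>N\<ge>1. \<forall>f\<in>F. \<forall>x y :: nat \<Rightarrow> 'a.
              range x \<subseteq> X \<and> range y \<subseteq> X \<and>
              (\<forall>i j. b_diam d (iter_orbit2 (T (f j)) (x (Suc i)) (T (f i) (x i))) \<le> \<delta> i \<and>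
                     b_diam d (iter_orbit2 (T (f j)) (y (Suc i)) (T (f i) (y i))) \<le> \<delta> i) \<longrightarrow>
              (\<forall>i\<ge>N. d (x i) (y i) < \<epsilon>)"
  \<comment> \<open>The witness depends on neither \<open>f\<close> nor the sequences. Going back n
    + 1 steps from i still leaves at least K + 1: errors are below \<eta> from there on, and the
    shift is positive, as the shift property asks.\<close>
  proof (intro exI[of _ "K + n + 2"] conjI ballI allI impI)
    fix f x y i
    assume f: "f \<in> F" and i: "i \<ge> K + n + 2"
      and xy: "range x \<subseteq> X \<and> range y \<subseteq> X \<and>
        (\<forall>i j. b_diam d (iter_orbit2 (T (f j)) (x (Suc i)) (T (f i) (x i))) \<le> \<delta> i \<and>
               b_diam d (iter_orbit2 (T (f j)) (y (Suc i)) (T (f i) (y i))) \<le> \<delta> i)"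
    \<comment> \<open>The window starts at \<open>k\<close> and ends exactly at \<open>i\<close>,
      because \<open>comp_upto T g n\<close> applies n + 1 maps.\<close>
    define k where "k = i - Suc n"
    define g where "g = (\<lambda>l. f (l + k))"
    have k: "k \<ge> 1" "k \<ge> K" and ik: "i = Suc n + k" using i unfolding k_def by auto
    have g: "g \<in> F" unfolding g_def using assms(6) f k by blast
    have close: "d (z i) (comp_upto T g n (z k)) \<le> C * \<eta>"
      if z: "range z \<subseteq> X"
        and err: "\<And>i j. b_diam d (iter_orbit2 (T (f j)) (z (Suc i)) (T (f i) (z i))) \<le> \<delta> i" for z
    proof -
      have zX: "z l \<in> X" for l using z by blast
      \<comment> \<open>All deviations in the window are measured by joint orbits of the single map
        \<open>T (f 0)\<close>, whose diameter dominates \<open>d\<close>.\<close>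
      have err': "b_diam d (iter_orbit2 (T (f 0)) (z (Suc l + k)) (T (g l) (z (l + k)))) \<le> \<eta>" for l
        using err[of 0 "l + k"] K[of "l + k"] k by (simp add: g_def)
      have "b_diam d (iter_orbit2 (T (f 0)) (z (Suc n + k)) (comp_upto T g n (z (0 + k)))) \<le> C * \<eta>"
        unfolding C_def
        by (rule inexact_orbit_deviation[where x = "\<lambda>l. z (l + k)", OF maps bounded])
          (use assms(4) zX err' in blast)+
      moreover have "d (z i) (comp_upto T g n (z k)) \<le>
          b_diam d (iter_orbit2 (T (f 0)) (z i) (comp_upto T g n (z k)))"
        by (rule dist_le_diam_orbits[OF maps bounded]) (use comp_upto_in[OF maps] zX in auto)
      ultimately show ?thesis by (simp add: ik)
    qed
    let ?u = "comp_upto T g n (x k)"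
    let ?v = "comp_upto T g n (y k)"
    have X: "x i \<in> X" "y i \<in> X" "x k \<in> X" "y k \<in> X" using xy by auto
    have uv: "?u \<in> X" "?v \<in> X" using comp_upto_in[OF maps] X by auto
    have dx: "d (x i) ?u \<le> C * \<eta>" and dy: "d ?v (y i) \<le> C * \<eta>"
      using close[of x] close[of y] xy sym[OF uv(2) X(2)] by auto
    \<comment> \<open>The chain from \<open>x i\<close> over \<open>?u\<close> and \<open>?v\<close>
      to \<open>y i\<close> is split first at \<open>?u\<close>, then at \<open>?v\<close>. Hence
      the first deviation gets weight s, while the middle distance and the second deviation get
      weight s^2.\<close>
    have "d ?u (y i) \<le> s * (d ?u ?v + d ?v (y i))"
      using triangle uv X by blast
    also have "\<dots> \<le> s * (d ?u ?v + C * \<eta>)"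
      using dy s by (intro mult_left_mono) auto
    finally have "d (x i) ?u + d ?u (y i) \<le> C * \<eta> + s * (d ?u ?v + C * \<eta>)"
      using dx by linarith
    then have "s * (d (x i) ?u + d ?u (y i)) \<le> s * (C * \<eta> + s * (d ?u ?v + C * \<eta>))"
      using s by (intro mult_left_mono) auto
    also have "\<dots> = a * (C * \<eta>) + s\<^sup>2 * d ?u ?v"
      by (simp add: a_def algebra_simps power2_eq_square)
    also have "\<dots> < \<epsilon> / 2 + \<epsilon> / 2"
    proof -
      have "s\<^sup>2 * d ?u ?v < s\<^sup>2 * (\<epsilon> / (2 * s\<^sup>2))"
        using n[OF g X(3,4)] s by (intro mult_strict_left_mono) auto
      also have "\<dots> = \<epsilon> / 2" using s by simp
      finally show ?thesis unfolding budget by simp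
    qed
    finally show "d (x i) (y i) < \<epsilon>"
      using triangle[OF X(1,2) uv(1)] by simp
  qed simp
qed

end
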